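(* Let $J\ge 2$ and $d\ge 1$ be integers, let $I:=dJ$, let $0<p_i<1$ and $q_i:=1-p_i$ for $i=0,1,\ldots,I-1$, and let $\mathbf{P}$ be the transition matrix on $\Sigma=\{0,1,\ldots,I-1\}\times\{0,1,\ldots,J-1\}$ defined in the context. Put $Q:=q_0q_1\cdots q_{I-1}$. Then the Markov chain in $\Sigma$ with one-step transition matrix $\mathbf{P}$ has a unique stationary distribution $\boldsymbol{\pi}$, and it is given recursively by $$\pi(i,0)=\frac{p_{i-1}+q_{i-1}\cdots q_{i-J}\,p_{i-J-1}+\cdots+q_{i-1}\cdots q_{i-(d-1)J}\,p_{i-(d-1)J-1}}{I(1-Q)}=\frac{1}{I(1-Q)}\sum_{k=0}^{d-1}\Bigl(\prod_{m=1}^{kJ}q_{i-m}\Bigr)p_{i-kJ-1}$$ for $i=0,1,\ldots,I-1$ (empty products are $1$), and $$\pi(i,j)=q_{i-1}\,\pi(i-1,j-1),\qquad i=0,1,\ldots,I-1,\quad j=1,2,\ldots,J-1,$$ where $p_{-i}:=p_{I-i}$ and $q_{-i}:=q_{I-i}$ for $i=1,2,\ldots,I$, and $\pi(-1,j):=\pi(I-1,j)$ for $j=0,1,\ldots,J-1$. Furthermore, $$\pi(i,0)+\pi(i,1)+\cdots+\pi(i,J-1)=\frac1I,\qquad i=0,1,\ldots,I-1.$$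
   Context: The transition matrix $\mathbf{P}=(P((i,j),(k,l)))$ on $\Sigma$ is $$P((i,j),(k,l))=\begin{cases}p_i&\text{if }(k,l)=(i+1 \bmod I,\,0)\text{ and }j\le J-2,\\ q_i&\text{if }(k,l)=(i+1\bmod I,\,j+1)\text{ and }j\le J-2,\\ 1&\text{if }(k,l)=(i+1\bmod I,\,0)\text{ and }j=J-1,\end{cases}$$ and $P((i,j),(k,l))=0$ otherwise. (Interpretation: a slot machine has a cam with $I$ positions which advances by one each coup; in cam position $i$ a coup is won (nonzero payout) with probability $p_i$; a pointer counts consecutive losses and resets to $0$ after a win or after $J$ consecutive losses.) A stationary distribution is a probability row vector $\boldsymbol{\pi}$ on $\Sigma$ with $\boldsymbol{\pi}=\boldsymbol{\pi}\mathbf{P}$. *)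

theory Defs
  imports Complex_Main
begin

definition states :: "nat \<Rightarrow> nat \<Rightarrow> (nat \<times> nat) set" where
  "states I J = {0..<I} \<times> {0..<J}"

fun trans_mat ::
  "nat \<Rightarrow> nat \<Rightarrow> (nat \<Rightarrow> real) \<Rightarrow> (nat \<Rightarrow> real) \<Rightarrow> nat \<times> nat \<Rightarrow> nat \<times> nat \<Rightarrow> real" where
  "trans_mat I J p q (i, j) (k, l) =
     (if (k, l) = ((i + 1) mod I, 0) \<and> j \<le> J - 2 then p i
      else if (k, l) = ((i + 1) mod I, j + 1) \<and> j \<le> J - 2 then q i
      else if (k, l) = ((i + 1) mod I, 0) \<and> j = J - 1 then 1
      else 0)"

text \<open>
  A vector on \<open>S\<close> is represented by a function that vanishes outside \<open>S\<close>, so that equality of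
  functions is equality of vectors.
\<close>

definition stationary_distribution ::
  "'s set \<Rightarrow> ('s \<Rightarrow> 's \<Rightarrow> real) \<Rightarrow> ('s \<Rightarrow> real) \<Rightarrow> bool" where
  "stationary_distribution S P \<pi> \<longleftrightarrow>
     (\<forall>x\<in>S. 0 \<le> \<pi> x) \<and> (\<forall>x. x \<notin> S \<longrightarrow> \<pi> x = 0) \<and> (\<Sum>x\<in>S. \<pi> x) = 1 \<and>
     (\<forall>y\<in>S. \<pi> y = (\<Sum>x\<in>S. \<pi> x * P x y))"

text \<open>
  Values at negative indices, by the convention that the value at \<open>- i\<close> is the value at \<open>I - i\<close>
  for \<open>1 \<le> i \<le> I\<close>; only meaningful for indices from \<open>- I\<close> to \<open>I - 1\<close>.
\<close>

definition wrap :: "nat \<Rightarrow> (nat \<Rightarrow> real) \<Rightarrow> int \<Rightarrow> real" where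
  "wrap I f k = f (nat (if k < 0 then int I + k else k))"

lemma trans_mat_nonneg:
  assumes "x \<in> states I J" and "\<And>i. i < I \<Longrightarrow> 0 \<le> p i \<and> 0 \<le> q i"
  shows "0 \<le> trans_mat I J p q x y"
  using assms by (cases x; cases y) (auto simp: states_def)

lemma trans_mat_row_sum:
  assumes "2 \<le> J" and "x \<in> states I J" and "\<And>i. i < I \<Longrightarrow> q i = 1 - p i"
  shows "(\<Sum>y\<in>states I J. trans_mat I J p q x y) = 1"
proof -
  obtain i j where x: "x = (i, j)" and i: "i < I" and j: "j < J"
    using assms(2) by (auto simp: states_def)
  let ?k = "(i + 1) mod I"
  have k: "?k < I" using i by simp
  show ?thesis
  proof (cases "j \<le> J - 2")
    case True
    have "(\<Sum>y\<in>states I J. trans_mat I J p q x y)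
        = (\<Sum>y\<in>{(?k, 0), (?k, j + 1)}. trans_mat I J p q x y)"
      by (rule sum.mono_neutral_right) (use k x True assms(1) in \<open>auto simp: states_def split: if_splits\<close>)
    then show ?thesis using x True assms(3)[OF i] by simp
  next
    case False
    then have j': "j = J - 1" using j by simp
    have "(\<Sum>y\<in>states I J. trans_mat I J p q x y) = (\<Sum>y\<in>{(?k, 0)}. trans_mat I J p q x y)"
      by (rule sum.mono_neutral_right) (use k x False assms(1) in \<open>auto simp: states_def split: if_splits\<close>)
    then show ?thesis using x j' False by simp
  qed
qed

end

theory Submission imports Defs begin

text \<open>
  The cam position is deterministic, so stationarity forces the marginal of the cam position to be
  uniform. Substituting this into the balance equation at pointer value \<open>0\<close> gives
  \<open>\<pi>(i,0) = p(i-1)/I + q(i-1) \<cdots> q(i-J) \<pi>(i-J,0)\<close>, and since \<open>I = d J\<close>, iterating \<open>d\<close> times returns to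
  \<open>\<pi>(i,0)\<close> with the factor \<open>Q < 1\<close>; solving yields the formula and uniqueness. Conversely, if \<open>\<pi>\<close> is
  defined by the formula, the defect \<open>U(i) = \<Sum>j. \<pi>(i,j) - 1/I\<close> satisfies \<open>U(i) = q(i-1) U(i-1)\<close>,
  hence \<open>U(i) = Q U(i)\<close> around the cycle and \<open>U = 0\<close>.
\<close>

section \<open>Periodic indexing by the integers\<close>

definition cyc :: "nat \<Rightarrow> (nat \<Rightarrow> 'a) \<Rightarrow> int \<Rightarrow> 'a" where
  "cyc I f k = f (nat (k mod int I))"

lemma cyc_of_nat: "i < I \<Longrightarrow> cyc I f (int i) = f i"
  by (simp add: cyc_def)

lemma cyc_minus_period: "cyc I f (i - int I) = cyc I f i"
  by (simp add: cyc_def)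

text \<open>\<open>wrap\<close> adds \<open>I\<close> at most once, so it agrees with reduction
  modulo \<open>I\<close> only on this window. The argument runs on \<open>cyc\<close>, which is
  periodic on all integers and lets shifts be iterated freely; \<open>wrap\<close> returns only in
  the final formulas.\<close>

lemma wrap_eq_cyc:
  assumes "- int I \<le> k" and "k < int I"
  shows "wrap I f k = cyc I f k"
proof (cases "k < 0")
  case True
  have "k mod int I = (k + int I) mod int I" by simp
  also have "\<dots> = int I + k" using assms True by (subst mod_pos_pos_trivial) auto
  finally show ?thesis using True by (simp add: wrap_def cyc_def)
next
  case False
  then show ?thesis using assms by (simp add: wrap_def cyc_def)
qed

lemma nat_mod_add_one:
  assumes "0 < I"
  shows "(nat (i mod int I) + 1) mod I = nat ((i + 1) mod int I)"
proof -
  have "int ((nat (i mod int I) + 1) mod I) = (i mod int I + 1) mod int I"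
    using assms by (simp add: zmod_int add.commute)
  also have "\<dots> = (i + 1) mod int I" by (simp add: mod_simps)
  finally show ?thesis by linarith
qed

section \<open>Backward products and linear recurrences\<close>

definition back_prod :: "(int \<Rightarrow> 'a::comm_monoid_mult) \<Rightarrow> nat \<Rightarrow> int \<Rightarrow> 'a" where
  "back_prod q n i = (\<Prod>m = 1..n. q (i - int m))"

lemma back_prod_0 [simp]: "back_prod q 0 i = 1"
  by (simp add: back_prod_def)

lemma back_prod_Suc: "back_prod q (Suc n) i = back_prod q n i * q (i - int (Suc n))"
  by (simp add: back_prod_def)

lemma back_prod_add: "back_prod q (m + n) i = back_prod q m i * back_prod q n (i - int m)"
  by (induction n) (simp_all add: back_prod_Suc mult.assoc diff_diff_eq add.left_commute)

lemma back_prod_Suc': "back_prod q (Suc n) i = q (i - 1) * back_prod q n (i - 1)"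
  using back_prod_add[of q 1 n i] by (simp add: back_prod_Suc)

text \<open>Substituting the recurrence into itself \<open>n\<close> times. It serves twice: with
  step \<open>J\<close> for the entries at pointer 0, and with step 1 and no inhomogeneity for the
  defect of the row sums.\<close>

lemma back_prod_unroll:
  fixes x :: "int \<Rightarrow> 'a::comm_ring_1"
  assumes "\<And>i. x i = a i + back_prod q J i * x (i - int J)"
  shows "x i = (\<Sum>k<n. back_prod q (k * J) i * a (i - int (k * J)))
    + back_prod q (n * J) i * x (i - int (n * J))"
proof (induction n)
  case 0
  show ?case by simp
next
  case (Suc n)
  have "back_prod q (n * J) i * x (i - int (n * J)) =
      back_prod q (n * J) i * a (i - int (n * J))
      + back_prod q (n * J + J) i * x (i - int (n * J) - int J)"
    by (subst assms) (simp only: back_prod_add distrib_left mult.assoc)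
  then show ?case
    using Suc by (simp only: sum.lessThan_Suc mult_Suc of_nat_add add.commute[of J] diff_diff_eq add.assoc)
qed

text \<open>Two lags in \<open>{1..I}\<close> differ by less than \<open>I\<close>, so they have
  distinct residues; a full turn therefore meets every position exactly once.\<close>

lemma back_prod_cyc_period:
  assumes "0 < I"
  shows "back_prod (cyc I q) I i = (\<Prod>k<I. q k)"
proof -
  let ?h = "\<lambda>m. nat ((i - int m) mod int I)"
  have inj: "inj_on ?h {1..I}"
  proof (rule inj_onI)
    fix m n assume mn: "m \<in> {1..I}" "n \<in> {1..I}" and "?h m = ?h n"
    then have "(i - int m) mod int I = (i - int n) mod int I"
      using assms by (simp add: nat_eq_iff)
    then have "int I dvd (i - int m) - (i - int n)" by (simp add: mod_eq_dvd_iff)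
    then have "int I dvd int n - int m" by simp
    moreover have "\<bar>int n - int m\<bar> < int I" using mn by auto
    ultimately show "m = n" using zdvd_not_zless[of "\<bar>int n - int m\<bar>" "int I"] by force
  qed
  moreover have "?h ` {1..I} = {..<I}"
    by (rule card_subset_eq) (use inj assms in \<open>auto simp: card_image nat_less_iff\<close>)
  ultimately have "bij_betw ?h {1..I} {..<I}" by (simp add: bij_betw_def)
  then show ?thesis
    unfolding back_prod_def cyc_def by (rule prod.reindex_bij_betw)
qed

text \<open>Only cam position \<open>i\<close> leads to its cyclic successor. Pointer 0 is reached
  by a win or by the forced reset from \<open>J - 1\<close>, any other pointer only by a loss.
  Naming the target as a successor avoids subtraction modulo \<open>I\<close>.\<close>

lemma sum_trans_mat:
  assumes "2 \<le> J" and "i < I" and "l < J"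
  shows "(\<Sum>x\<in>states I J. \<pi> x * trans_mat I J p q x ((i + 1) mod I, l)) =
    (if l = 0 then p i * (\<Sum>j<J - 1. \<pi> (i, j)) + \<pi> (i, J - 1) else q i * \<pi> (i, l - 1))"
proof -
  let ?y = "((i + 1) mod I, l)"
  have pred: "a = i" if "a < I" "(a + 1) mod I = (i + 1) mod I" for a
    using that assms(2) by (cases "a + 1 = I"; cases "i + 1 = I") auto
  have "(\<Sum>x\<in>states I J. \<pi> x * trans_mat I J p q x ?y) =
      (\<Sum>x\<in>{i} \<times> {..<J}. \<pi> x * trans_mat I J p q x ?y)"
    by (rule sum.mono_neutral_right)
      (use assms in \<open>auto simp: states_def split: if_splits intro!: pred dest: sym\<close>)
  also have "\<dots> = (\<Sum>j<J. \<pi> (i, j) * trans_mat I J p q (i, j) ?y)"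
    by (rule sum.reindex_cong[where l = "Pair i"])
      (auto simp: inj_on_def simp del: trans_mat.simps)
  also have "\<dots> = (if l = 0 then p i * (\<Sum>j<J - 1. \<pi> (i, j)) + \<pi> (i, J - 1) else q i * \<pi> (i, l - 1))"
  proof (cases "l = 0")
    case True
    obtain n where J: "J = Suc n" using assms(1) by (cases J) auto
    have "(\<Sum>j<n. \<pi> (i, j) * trans_mat I J p q (i, j) ?y) = (\<Sum>j<n. p i * \<pi> (i, j))"
      by (rule sum.cong) (use True J in auto)
    \<comment> \<open>The last pointer value \<open>n = J - 1\<close> must fail the test
      \<open>j \<le> J - 2\<close> to get the forced reset. Under truncated subtraction this relies
      on \<open>2 \<le> J\<close>.\<close>
    moreover have "\<not> n \<le> n - 1" using J assms(1) by simp
    ultimately show ?thesis using True J by (simp add: sum_distrib_left)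
  next
    case False
    have "(\<Sum>j<J. \<pi> (i, j) * trans_mat I J p q (i, j) ?y) =
        (\<Sum>j\<in>{l - 1}. \<pi> (i, j) * trans_mat I J p q (i, j) ?y)"
      by (rule sum.mono_neutral_right) (use False assms in auto)
    moreover have "l - 1 \<le> J - 2" using assms(3) by simp
    ultimately show ?thesis using False by simp
  qed
  finally show ?thesis .
qed

section \<open>The chain, the candidate values and the balance equations\<close>

locale slot_machine =
  fixes I J d :: nat and p q :: "nat \<Rightarrow> real"
  assumes J: "2 \<le> J" and d: "1 \<le> d" and I: "I = d * J"
    and p: "\<And>i. i < I \<Longrightarrow> 0 < p i \<and> p i < 1"
    and q: "\<And>i. i < I \<Longrightarrow> q i = 1 - p i"
begin

abbreviation "pc \<equiv> cyc I p"
abbreviation "qc \<equiv> cyc I q"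
abbreviation "Q \<equiv> \<Prod>i<I. q i"

text \<open>The claimed value of \<open>\<pi> (i, 0)\<close>, extended periodically to all integers
  so that it can be compared with its shift by \<open>J\<close>.\<close>

definition renewal :: "int \<Rightarrow> real" where
  "renewal i = 1 / (real I * (1 - Q)) *
     (\<Sum>k<d. back_prod qc (k * J) i * pc (i - int (k * J) - 1))"

lemma I_pos: "0 < I"
  using I J d by simp

lemma nat_mod_less: "nat (i mod int I) < I"
  using I_pos by (simp add: nat_less_iff)

lemma qc_eq: "qc i = 1 - pc i"
  by (simp add: cyc_def q nat_mod_less)

lemma pc_pos: "0 < pc i" and qc_pos: "0 < qc i"
  using p[OF nat_mod_less, of i] by (simp_all add: cyc_def q nat_mod_less)

lemma Q_less_1: "Q < 1"
proof -
  have "Q < (\<Prod>i<I. 1::real)"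
    by (rule prod_mono_strict[where i = 0])
      (use p q I_pos in \<open>auto simp: less_imp_le\<close>)
  then show ?thesis by simp
qed

lemma back_prod_Q: "back_prod qc I i = Q"
  by (rule back_prod_cyc_period[OF I_pos])

lemma back_prod_pos: "0 < back_prod qc n i"
  by (simp add: back_prod_def prod_pos qc_pos)

lemma renewal_pos: "0 < renewal i"
  unfolding renewal_def
  by (intro mult_pos_pos sum_pos divide_pos_pos)
    (use Q_less_1 I_pos d in \<open>auto simp: back_prod_pos pc_pos lessThan_empty_iff\<close>)

lemma back_prod_J: "back_prod qc J i = qc (i - 1) * back_prod qc (J - 1) (i - 1)"
  using J back_prod_Suc'[of qc "J - 1" i] by simp

text \<open>Shifting by \<open>J\<close> turns summand \<open>k\<close> into summand
  \<open>k + 1\<close>. Summand \<open>d\<close> has gone once around the cycle because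
  \<open>d * J = I\<close>, so it is \<open>Q\<close> times summand 0; the resulting defect
  \<open>(1 - Q) * pc (i - 1)\<close> is what the normalising factor turns into
  \<open>pc (i - 1) / I\<close>.\<close>

lemma renewal_rec: "renewal i = pc (i - 1) / real I + back_prod qc J i * renewal (i - int J)"
proof -
  let ?t = "\<lambda>k. back_prod qc (k * J) i * pc (i - int (k * J) - 1)"
  have t: "back_prod qc J i * (back_prod qc (k * J) (i - int J) * pc (i - int J - int (k * J) - 1))
      = ?t (Suc k)" for k
    by (simp add: back_prod_add algebra_simps)
  have "?t d = Q * pc (i - 1)"
    using back_prod_Q cyc_minus_period[of I p "i - 1"] by (simp add: I algebra_simps)
  moreover have "(\<Sum>k<d. ?t (Suc k)) = (\<Sum>k<d. ?t k) + ?t d - ?t 0"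
    using sum.lessThan_Suc_shift[of ?t d] sum.lessThan_Suc[of ?t d] by simp
  ultimately have s: "(\<Sum>k<d. ?t (Suc k)) = (\<Sum>k<d. ?t k) - (1 - Q) * pc (i - 1)"
    by (simp add: algebra_simps)
  have "back_prod qc J i * renewal (i - int J) = 1 / (real I * (1 - Q)) * (\<Sum>k<d. ?t (Suc k))"
    unfolding renewal_def t[symmetric] sum_distrib_left by (simp add: mult.left_commute)
  also have "\<dots> = renewal i - pc (i - 1) / real I"
    unfolding s renewal_def using Q_less_1 I_pos by (simp add: field_simps)
  finally show ?thesis by simp
qed

text \<open>Every position is a residue of some integer \<open>i\<close>, with predecessor the
  residue of \<open>i - 1\<close>, so the balance equations may be stated over all integers. This
  form serves both to exploit a given \<open>\<pi>\<close> and to verify the candidate.\<close>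

lemma stationary_iff:
  "stationary_distribution (states I J) (trans_mat I J p q) \<pi> \<longleftrightarrow>
    (\<forall>x\<in>states I J. 0 \<le> \<pi> x) \<and> (\<forall>x. x \<notin> states I J \<longrightarrow> \<pi> x = 0) \<and>
    (\<Sum>x\<in>states I J. \<pi> x) = 1 \<and>
    (\<forall>i. cyc I (\<lambda>a. \<pi> (a, 0)) i =
       pc (i - 1) * (\<Sum>j<J - 1. cyc I (\<lambda>a. \<pi> (a, j)) (i - 1)) + cyc I (\<lambda>a. \<pi> (a, J - 1)) (i - 1)) \<and>
    (\<forall>i. \<forall>j<J - 1. cyc I (\<lambda>a. \<pi> (a, Suc j)) i = qc (i - 1) * cyc I (\<lambda>a. \<pi> (a, j)) (i - 1))"
proof -
  let ?B = "\<lambda>y. \<pi> y = (\<Sum>x\<in>states I J. \<pi> x * trans_mat I J p q x y)"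
  let ?r = "\<lambda>i::int. nat (i mod int I)"
  have succ: "(?r (i - 1) + 1) mod I = ?r i" for i
    using nat_mod_add_one[OF I_pos, of "i - 1"] by simp
  have "(\<forall>y\<in>states I J. ?B y) \<longleftrightarrow> (\<forall>i. \<forall>l<J. ?B (?r i, l))"
  proof
    assume "\<forall>y\<in>states I J. ?B y"
    then show "\<forall>i. \<forall>l<J. ?B (?r i, l)" by (simp add: states_def nat_mod_less)
  next
    assume B: "\<forall>i. \<forall>l<J. ?B (?r i, l)"
    show "\<forall>y\<in>states I J. ?B y"
    proof
      fix y assume "y \<in> states I J"
      then obtain k l where "y = (k, l)" "k < I" "l < J" by (auto simp: states_def)
      then show "?B y" using B[rule_format, of l "int k"] by simp
    qed
  qed
  also have "\<dots> \<longleftrightarrow> (\<forall>i. ?B (?r i, 0) \<and> (\<forall>j<J - 1. ?B (?r i, Suc j)))"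
    using J All_less_Suc2[of "J - 1"] by simp
  finally have "(\<forall>y\<in>states I J. ?B y) \<longleftrightarrow> (\<forall>i. ?B (?r i, 0) \<and> (\<forall>j<J - 1. ?B (?r i, Suc j)))" .
  moreover have "?B (?r i, l) \<longleftrightarrow> \<pi> (?r i, l) =
      (if l = 0 then p (?r (i - 1)) * (\<Sum>j<J - 1. \<pi> (?r (i - 1), j)) + \<pi> (?r (i - 1), J - 1)
       else q (?r (i - 1)) * \<pi> (?r (i - 1), l - 1))" if "l < J" for i l
    using sum_trans_mat[OF J nat_mod_less that, of \<pi> p q "i - 1"] unfolding succ by simp
  ultimately show ?thesis
    unfolding stationary_distribution_def cyc_def using J by (auto simp: less_diff_conv)
qed

lemma sum_states:
  "(\<Sum>x\<in>states I J. \<pi> x) = (\<Sum>i<I. \<Sum>j<J. \<pi> (i, j))"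
  by (simp add: states_def sum.cartesian_product atLeast0LessThan)

lemma split_last: "(\<Sum>j<J. f j) = (\<Sum>j<J - 1. f j) + f (J - 1)" for f :: "nat \<Rightarrow> real"
  using J sum.lessThan_Suc[of f "J - 1"] by simp

lemma split_first: "(\<Sum>j<J. f j) = f 0 + (\<Sum>j<J - 1. f (Suc j))" for f :: "nat \<Rightarrow> real"
  using J sum.lessThan_Suc_shift[of f "J - 1"] by simp

section \<open>Consequences of stationarity\<close>

context
  fixes \<pi> :: "nat \<times> nat \<Rightarrow> real"
  assumes stat: "stationary_distribution (states I J) (trans_mat I J p q) \<pi>"
begin

abbreviation "pic i j \<equiv> cyc I (\<lambda>a. \<pi> (a, j)) i"

lemma stationary_0:
  "pic i 0 = pc (i - 1) * (\<Sum>j<J - 1. pic (i - 1) j) + pic (i - 1) (J - 1)"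
  using stat unfolding stationary_iff by blast

lemma stationary_Suc: "j < J - 1 \<Longrightarrow> pic i (Suc j) = qc (i - 1) * pic (i - 1) j"
  using stat unfolding stationary_iff by blast

lemma stationary_row_sum: "(\<Sum>j<J. pic i j) = 1 / real I"
proof -
  \<comment> \<open>The coefficients \<open>pc\<close> and \<open>qc\<close> of each entry with
    pointer below \<open>J - 1\<close> add up to 1, and the last entry is carried over
    whole.\<close>
  have step: "(\<Sum>j<J. pic i j) = (\<Sum>j<J. pic (i - 1) j)" for i
    unfolding split_first[of "pic i"] split_last[of "pic (i - 1)"]
    by (subst stationary_0)
      (simp add: stationary_Suc sum_distrib_left[symmetric], simp add: qc_eq algebra_simps)
  have const: "(\<Sum>j<J. pic i j) = (\<Sum>j<J. pic 0 j)" for i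
    by (induction i rule: int_induct[where k = 0]) (use step[of "_ + 1"] step in auto)
  have "1 = (\<Sum>i<I. \<Sum>j<J. \<pi> (i, j))"
    using stat by (simp add: stationary_distribution_def sum_states)
  also have "\<dots> = (\<Sum>i<I. \<Sum>j<J. pic (int i) j)"
    by (intro sum.cong refl) (simp add: cyc_of_nat)
  also have "\<dots> = real I * (\<Sum>j<J. pic i j)"
    by (subst const) (simp add: const[of i])
  finally show ?thesis using I_pos by (simp add: field_simps)
qed

text \<open>Pointer \<open>j\<close> is reached only through \<open>j\<close> successive losses
  starting from pointer 0.\<close>

lemma stationary_back_prod: "j < J \<Longrightarrow> pic i j = back_prod qc j i * pic (i - int j) 0"
proof (induction j arbitrary: i)
  case (Suc j)
  then show ?case by (simp add: stationary_Suc back_prod_Suc' algebra_simps)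
qed simp

lemma stationary_renewal: "pic i 0 = renewal i"
proof -
  have rec: "pic i 0 = pc (i - 1) / real I + back_prod qc J i * pic (i - int J) 0" for i
  proof -
    \<comment> \<open>The known row sum eliminates all entries but the last, which in turn is traced
      back to pointer 0 at \<open>i - J\<close>.\<close>
    have s: "(\<Sum>j<J - 1. pic (i - 1) j) = 1 / real I - pic (i - 1) (J - 1)"
      using stationary_row_sum[of "i - 1"] split_last[of "pic (i - 1)"] by simp
    have "pic i 0 = pc (i - 1) / real I + qc (i - 1) * pic (i - 1) (J - 1)"
      using stationary_0[of i] unfolding s by (simp add: qc_eq algebra_simps)
    also have "qc (i - 1) * pic (i - 1) (J - 1) = back_prod qc J i * pic (i - int J) 0"
      using stationary_back_prod[of "J - 1" "i - 1"] J
      by (simp add: back_prod_J)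
    finally show ?thesis .
  qed
  \<comment> \<open>After \<open>d\<close> unrollings the shift is \<open>d * J = I\<close>, so the
    same unknown reappears with factor \<open>Q\<close>; \<open>Q < 1\<close> allows solving for
    it.\<close>
  have "pic i 0 = (\<Sum>k<d. back_prod qc (k * J) i * (pc (i - int (k * J) - 1) / real I)) + Q * pic i 0"
    using back_prod_unroll[of "\<lambda>i. pic i 0" "\<lambda>i. pc (i - 1) / real I" qc J i d, OF rec]
    unfolding I[symmetric] back_prod_Q cyc_minus_period .
  then have "(1 - Q) * pic i 0 =
      (\<Sum>k<d. back_prod qc (k * J) i * pc (i - int (k * J) - 1)) / real I"
    by (simp add: algebra_simps sum_divide_distrib)
  then show ?thesis
    unfolding renewal_def using Q_less_1 I_pos by (simp add: field_simps)
qed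

lemma stationary_eq: "j < J \<Longrightarrow> pic i j = back_prod qc j i * renewal (i - int j)"
  by (simp add: stationary_back_prod stationary_renewal)

end

section \<open>Existence and uniqueness\<close>

definition stat_vec :: "nat \<times> nat \<Rightarrow> real" where
  "stat_vec = (\<lambda>(i, j). if i < I \<and> j < J
     then back_prod qc j (int i) * renewal (int i - int j) else 0)"

lemma cyc_mod: "cyc I f (i mod int I - k) = cyc I f (i - k)"
  by (simp add: cyc_def mod_simps)

lemma back_prod_mod: "back_prod qc n (i mod int I) = back_prod qc n i"
  by (simp add: back_prod_def cyc_mod)

lemma renewal_mod: "renewal (i mod int I - k) = renewal (i - k)"
  by (simp add: renewal_def back_prod_def diff_diff_eq cyc_mod)

text \<open>Both factors depend on \<open>i\<close> only through its residue, so the closed form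
  used for representatives holds at all integers and steps back past position 0 need no case
  split.\<close>

lemma stat_vec_cyc:
  assumes "j < J"
  shows "cyc I (\<lambda>a. stat_vec (a, j)) i = back_prod qc j i * renewal (i - int j)"
proof -
  have "cyc I (\<lambda>a. stat_vec (a, j)) i =
      back_prod qc j (i mod int I) * renewal (i mod int I - int j)"
    using assms I_pos nat_mod_less
    by (simp only: cyc_def[of I "\<lambda>a. stat_vec (a, j)"]) (simp add: stat_vec_def)
  then show ?thesis by (simp add: back_prod_mod renewal_mod)
qed

lemma stat_vec_row_sum: "(\<Sum>j<J. cyc I (\<lambda>a. stat_vec (a, j)) i) = 1 / real I"
proof -
  define U where "U i = (\<Sum>j<J. back_prod qc j i * renewal (i - int j)) - 1 / real I" for i
  \<comment> \<open>Written with a zero summand and a product of length 1 to fit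
    \<open>back_prod_unroll\<close>; \<open>I\<close> steps then make a full turn.\<close>
  have "U i = 0 + back_prod qc 1 i * U (i - int 1)" for i
  proof -
    let ?s = "\<Sum>j<J - 1. back_prod qc j (i - 1) * renewal (i - 1 - int j)"
    have "back_prod qc J i * renewal (i - int J)
        = qc (i - 1) * (back_prod qc (J - 1) (i - 1) * renewal (i - 1 - int (J - 1)))"
      using J by (simp add: back_prod_J)
    moreover have "(\<Sum>j<J - 1. back_prod qc (Suc j) i * renewal (i - int (Suc j))) = qc (i - 1) * ?s"
      by (simp add: back_prod_Suc' sum_distrib_left algebra_simps)
    \<comment> \<open>The entry at pointer 0 is expanded by \<open>renewal_rec\<close>; its second
      summand is \<open>qc (i - 1)\<close> times the last entry of the previous row, completing the
      shifted row sum.\<close>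
    ultimately have "U i = pc (i - 1) / real I
        + qc (i - 1) * (back_prod qc (J - 1) (i - 1) * renewal (i - 1 - int (J - 1)))
        + qc (i - 1) * ?s - 1 / real I"
      unfolding U_def split_first using renewal_rec[of i] by simp
    also have "\<dots> = qc (i - 1) * U (i - 1)"
      unfolding U_def split_last by (simp add: qc_eq algebra_simps add_divide_distrib[symmetric])
    finally show ?thesis by (simp add: back_prod_Suc)
  qed
  from back_prod_unroll[of U "\<lambda>_. 0" qc 1 i I, OF this]
  have "U i = Q * U (i - int I)" by (simp add: back_prod_Q)
  moreover have "U (i - int I) = U i"
    using back_prod_mod[of _ "i - int I"] back_prod_mod[of _ i]
      renewal_mod[of "i - int I"] renewal_mod[of i]
    by (simp add: U_def)
  ultimately have "(1 - Q) * U i = 0" by (simp add: algebra_simps)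
  then have "U i = 0" using Q_less_1 by simp
  then show ?thesis by (simp add: U_def stat_vec_cyc)
qed

lemma stationary_stat_vec: "stationary_distribution (states I J) (trans_mat I J p q) stat_vec"
  unfolding stationary_iff
proof (intro conjI allI impI ballI)
  show "0 \<le> stat_vec x" for x
    by (cases x) (simp add: stat_vec_def less_imp_le back_prod_pos renewal_pos)
  show "stat_vec x = 0" if "x \<notin> states I J" for x
    using that by (cases x) (auto simp: stat_vec_def states_def)
  have "(\<Sum>x\<in>states I J. stat_vec x) = (\<Sum>i<I. \<Sum>j<J. cyc I (\<lambda>a. stat_vec (a, j)) (int i))"
    unfolding sum_states by (intro sum.cong refl) (simp add: cyc_of_nat)
  then show "(\<Sum>x\<in>states I J. stat_vec x) = 1"
    using I_pos by (simp add: stat_vec_row_sum)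
  show suc: "cyc I (\<lambda>a. stat_vec (a, Suc j)) i = qc (i - 1) * cyc I (\<lambda>a. stat_vec (a, j)) (i - 1)"
    if "j < J - 1" for i j
    using that by (simp add: stat_vec_cyc back_prod_Suc' algebra_simps)
  fix i
  let ?s = "\<lambda>i j. cyc I (\<lambda>a. stat_vec (a, j)) i"
  \<comment> \<open>Rows \<open>i\<close> and \<open>i - 1\<close> have equal sums, and the entries
    of row \<open>i\<close> beyond pointer 0 are \<open>qc (i - 1)\<close> times those of row
    \<open>i - 1\<close>. The equation at pointer 0 is what remains.\<close>
  have "?s i 0 + qc (i - 1) * (\<Sum>j<J - 1. ?s (i - 1) j)
      = (\<Sum>j<J - 1. ?s (i - 1) j) + ?s (i - 1) (J - 1)"
    using stat_vec_row_sum[of i] stat_vec_row_sum[of "i - 1"]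
    unfolding split_first[of "?s i"] split_last[of "?s (i - 1)"]
    by (simp add: suc sum_distrib_left)
  then show "?s i 0 = pc (i - 1) * (\<Sum>j<J - 1. ?s (i - 1) j) + ?s (i - 1) (J - 1)"
    by (simp add: qc_eq algebra_simps)
qed

lemma stationary_unique:
  assumes "stationary_distribution (states I J) (trans_mat I J p q) \<pi>"
  shows "\<pi> = stat_vec"
proof
  fix x
  show "\<pi> x = stat_vec x"
  proof (cases "x \<in> states I J")
    case True
    then obtain i j where "x = (i, j)" "i < I" "j < J" by (auto simp: states_def)
    then show ?thesis
      using stationary_eq[OF assms, of j "int i"] stat_vec_cyc[of j "int i"] by (simp add: cyc_of_nat)
  next
    case False
    then show ?thesis
      using assms stationary_stat_vec by (cases x) (simp add: stationary_distribution_def)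
  qed
qed

section \<open>Return to the index convention of the statement\<close>

lemma renewal_wrap:
  assumes "i < I"
  shows "renewal (int i) = 1 / (real I * (1 - Q)) * (\<Sum>k = 0..d - 1.
    (\<Prod>m = 1..k * J. wrap I q (int i - int m)) * wrap I p (int i - int (k * J) - 1))"
proof -
  \<comment> \<open>The furthest lag in the formula is \<open>k * J + 1\<close> with
    \<open>k \<le> d - 1\<close>. It does not exceed \<open>I\<close>, so all indices stay where
    \<open>wrap\<close> and \<open>cyc\<close> agree.\<close>
  have le: "k * J + 1 \<le> I" if "k \<le> d - 1" for k
  proof -
    have "(k + 1) * J \<le> d * J" using that d by (intro mult_right_mono) auto
    then show ?thesis using I J by simp
  qed
  have "back_prod qc (k * J) (int i) * pc (int i - int (k * J) - 1) =
      (\<Prod>m = 1..k * J. wrap I q (int i - int m)) * wrap I p (int i - int (k * J) - 1)"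
    if "k \<le> d - 1" for k
  proof -
    have "back_prod qc (k * J) (int i) = (\<Prod>m = 1..k * J. wrap I q (int i - int m))"
      unfolding back_prod_def
    proof (rule prod.cong)
      fix m assume "m \<in> {1..k * J}"
      then show "qc (int i - int m) = wrap I q (int i - int m)"
        using le[OF that] assms by (subst wrap_eq_cyc) auto
    qed simp
    moreover have "pc (int i - int (k * J) - 1) = wrap I p (int i - int (k * J) - 1)"
      using le[OF that] assms by (subst wrap_eq_cyc) (auto simp del: of_nat_mult)
    ultimately show ?thesis by simp
  qed
  moreover have "{..<d} = {0..d - 1}" using d by auto
  ultimately show ?thesis unfolding renewal_def by (simp del: of_nat_mult)
qed

end

theorem theorem1:
  fixes I J d :: nat and p q :: "nat \<Rightarrow> real" and Q :: real
  assumes "2 \<le> J" and "1 \<le> d" and "I = d * J"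
    and "\<And>i. i < I \<Longrightarrow> 0 < p i \<and> p i < 1"
    and "\<And>i. i < I \<Longrightarrow> q i = 1 - p i"
    and "Q = (\<Prod>i<I. q i)"
  shows "(\<exists>!\<pi>. stationary_distribution (states I J) (trans_mat I J p q) \<pi>) \<and>
    (\<forall>\<pi>. stationary_distribution (states I J) (trans_mat I J p q) \<pi> \<longrightarrow>
      (\<forall>i<I. \<pi> (i, 0) =
         1 / (real I * (1 - Q)) *
         (\<Sum>k = 0..d - 1.
            (\<Prod>m = 1..k * J. wrap I q (int i - int m)) * wrap I p (int i - int (k * J) - 1))) \<and>
      (\<forall>i<I. \<forall>j\<in>{1..J - 1}.
         \<pi> (i, j) = wrap I q (int i - 1) * wrap I (\<lambda>i'. \<pi> (i', j - 1)) (int i - 1)) \<and>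
      (\<forall>i<I. (\<Sum>j = 0..J - 1. \<pi> (i, j)) = 1 / real I))"
proof -
  interpret slot_machine I J d p q
    using assms(1-5) by unfold_locales
  show ?thesis
  proof (intro conjI allI impI ballI)
    show "\<exists>!\<pi>. stationary_distribution (states I J) (trans_mat I J p q) \<pi>"
      using stationary_stat_vec stationary_unique by blast
  next
    fix \<pi> i
    assume stat: "stationary_distribution (states I J) (trans_mat I J p q) \<pi>" and i: "i < I"
    show "\<pi> (i, 0) = 1 / (real I * (1 - Q)) * (\<Sum>k = 0..d - 1.
        (\<Prod>m = 1..k * J. wrap I q (int i - int m)) * wrap I p (int i - int (k * J) - 1))"
      using stationary_renewal[OF stat, of "int i"] renewal_wrap[OF i] i assms(6)
      by (simp add: cyc_of_nat)
    show "\<pi> (i, j) = wrap I q (int i - 1) * wrap I (\<lambda>i'. \<pi> (i', j - 1)) (int i - 1)"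
      if "j \<in> {1..J - 1}" for j
    proof -
      have "j - 1 < J - 1" using that by auto
      then show ?thesis
        using stationary_Suc[OF stat, of "j - 1" "int i"] that i
        by (simp add: wrap_eq_cyc cyc_of_nat)
    qed
    have "{0..J - 1} = {..<J}" using assms(1) by auto
    then show "(\<Sum>j = 0..J - 1. \<pi> (i, j)) = 1 / real I"
      using stationary_row_sum[OF stat, of "int i"] i by (simp add: cyc_of_nat)
  qed
qed

end
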